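(* For every integer $m\ge0$ and every odd positive integer $j$, $$\Delta_{\mathbf d}(2^m\cdot j)=\Delta_{\mathbf d}(j)^{2^m}\cdot\Delta_{\mathbf d}(2^m).$$
   Context: The period-doubling sequence $\mathbf d=(d_n)_{n\ge 0}=1011101010111011\cdots$ is the fixed point starting with $1$ of the morphism $1\mapsto 10$, $0\mapsto 11$. For $n\ge1$, $\Delta_{\mathbf d}(n)=\det(d_{a+b})_{0\le a,b\le n-1}$. *)

theory Defs
  imports "HOL-Library.Stream" "Jordan_Normal_Form.Determinant"
begin

text \<open>Images of the letters \<open>1\<close> and \<open>0\<close>.  Letters are integers because they become matrix
  entries; only \<open>0\<close> and \<open>1\<close> matter (see \<open>period_doubling_binary\<close>).\<close>

definition pd_morphism :: "int \<Rightarrow> int list" where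
  "pd_morphism a = (if a = 1 then [1, 0] else [1, 1])"

text \<open>The image of an infinite word under a morphism is the concatenation \<open>flat\<close> of the images
  of its letters.\<close>

definition pd_word :: "int stream" where
  "pd_word = (THE w. shd w = 1 \<and> flat (smap pd_morphism w) = w)"

definition period_doubling :: "nat \<Rightarrow> int" where
  "period_doubling n = pd_word !! n"

definition hankel_matrix :: "(nat \<Rightarrow> 'a) \<Rightarrow> nat \<Rightarrow> 'a mat" where
  "hankel_matrix u n = mat n n (\<lambda>(a, b). u (a + b))"

definition hankel_det :: "(nat \<Rightarrow> 'a :: comm_ring_1) \<Rightarrow> nat \<Rightarrow> 'a" where
  "hankel_det u n = det (hankel_matrix u n)"

text \<open>The description in \<open>pd_word\<close> is proper: the fixed point exists and is unique.\<close>

lemma stream_eq_if_snth_eq: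
  assumes "\<And>n. s !! n = t !! n"
  shows "s = t"
proof -
  have "snth s = snth t" using assms by auto
  then show ?thesis by (metis stream_smap_nats)
qed

lemma snth_flat_pd:
  "flat (smap pd_morphism w) !! (2 * n) = 1 \<and>
   flat (smap pd_morphism w) !! (2 * n + 1) = (if w !! n = 1 then 0 else 1)"
proof (induction n arbitrary: w)
  case 0
  have "flat (smap pd_morphism w) = pd_morphism (shd w) @- flat (smap pd_morphism (stl w))"
    by (subst flat_unfold) (simp_all add: pd_morphism_def)
  then show ?case by (simp add: pd_morphism_def shift_snth)
next
  case (Suc n)
  have unf: "flat (smap pd_morphism w) = pd_morphism (shd w) @- flat (smap pd_morphism (stl w))"
    by (subst flat_unfold) (simp_all add: pd_morphism_def)
  have len: "length (pd_morphism a) = 2" for a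
    by (simp add: pd_morphism_def)
  have "flat (smap pd_morphism w) !! (k + 2) = flat (smap pd_morphism (stl w)) !! k" for k
    unfolding unf shift_snth len by simp
  from this[of "2 * n"] this[of "2 * n + 1"]
  have "flat (smap pd_morphism w) !! (2 * Suc n) = flat (smap pd_morphism (stl w)) !! (2 * n)"
    and "flat (smap pd_morphism w) !! (2 * Suc n + 1) =
      flat (smap pd_morphism (stl w)) !! (2 * n + 1)"
    by (metis mult_Suc_right add.commute, metis mult_Suc_right add.commute add.assoc)
  with Suc.IH[of "stl w"] show ?case
    by (metis snth.simps(2))
qed

lemma pd_fixed_point_iff:
  "flat (smap pd_morphism w) = w \<longleftrightarrow>
   (\<forall>n. w !! (2 * n) = 1 \<and> w !! (2 * n + 1) = (if w !! n = 1 then 0 else 1))"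
proof
  assume "flat (smap pd_morphism w) = w"
  then show "\<forall>n. w !! (2 * n) = 1 \<and> w !! (2 * n + 1) = (if w !! n = 1 then 0 else 1)"
    using snth_flat_pd[of w] by metis
next
  assume rec: "\<forall>n. w !! (2 * n) = 1 \<and> w !! (2 * n + 1) = (if w !! n = 1 then 0 else 1)"
  have "flat (smap pd_morphism w) !! k = w !! k" for k
  proof (cases "even k")
    case True
    then obtain n where "k = 2 * n" by (elim evenE)
    then show ?thesis using rec snth_flat_pd[of w n] by simp
  next
    case False
    then obtain n where k: "k = 2 * n + 1" by (elim oddE)
    show ?thesis unfolding k using rec snth_flat_pd[of w n] by metis
  qed
  then show "flat (smap pd_morphism w) = w"
    by (rule stream_eq_if_snth_eq)
qed

function pd_aux :: "nat \<Rightarrow> int" where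
  "pd_aux n = (if even n then 1 else if pd_aux (n div 2) = 1 then 0 else 1)"
  by auto
termination by (relation "Wellfounded.measure id") (auto elim: oddE)

declare pd_aux.simps [simp del]

lemma pd_word_ex1: "\<exists>!w. shd w = 1 \<and> flat (smap pd_morphism w) = w"
proof (rule ex1I)
  let ?w = "smap pd_aux nats"
  have "pd_aux (2 * n) = 1 \<and> pd_aux (2 * n + 1) = (if pd_aux n = 1 then 0 else 1)" for n
    by (simp add: pd_aux.simps[of "2 * n"] pd_aux.simps[of "2 * n + 1"]
        pd_aux.simps[of "Suc (2 * n)"])
  then show "shd ?w = 1 \<and> flat (smap pd_morphism ?w) = ?w"
    unfolding pd_fixed_point_iff by (simp add: pd_aux.simps[of 0])
next
  fix w :: "int stream"
  assume "shd w = 1 \<and> flat (smap pd_morphism w) = w"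
  then have rec: "w !! (2 * n) = 1" "w !! (2 * n + 1) = (if w !! n = 1 then 0 else 1)" for n
    unfolding pd_fixed_point_iff by blast+
  have "w !! n = pd_aux n" for n
  proof (induction n rule: less_induct)
    case (less n)
    show ?case
    proof (cases "even n")
      case True
      then obtain k where "n = 2 * k" by (elim evenE)
      then show ?thesis using rec(1)[of k] by (simp add: pd_aux.simps[of "2 * k"])
    next
      case False
      then obtain k where k: "n = 2 * k + 1" by (elim oddE)
      have "w !! k = pd_aux k" using less[of k] k by simp
      moreover have "pd_aux (2 * k + 1) = (if pd_aux k = 1 then 0 else 1)"
        by (subst pd_aux.simps) simp
      ultimately show ?thesis unfolding k using rec(2)[of k] by simp
    qed
  qed
  then show "w = smap pd_aux nats"
    by (intro stream_eq_if_snth_eq) simp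
qed

lemma pd_word_fixed_point:
  "shd pd_word = 1" "flat (smap pd_morphism pd_word) = pd_word"
  using theI'[OF pd_word_ex1] unfolding pd_word_def by blast+

lemma period_doubling_even [simp]: "period_doubling (2 * n) = 1"
  and period_doubling_odd_if:
    "period_doubling (2 * n + 1) = (if period_doubling n = 1 then 0 else 1)"
  using pd_word_fixed_point(2) unfolding pd_fixed_point_iff period_doubling_def by blast+

lemma period_doubling_binary: "period_doubling n \<in> {0, 1}"
proof (cases "even n")
  case True
  then show ?thesis by (elim evenE) simp
next
  case False
  then obtain k where "n = 2 * k + 1" by (elim oddE)
  then show ?thesis using period_doubling_odd_if[of k] by simp
qed

lemma period_doubling_odd: "period_doubling (2 * n + 1) = 1 - period_doubling n"
  using period_doubling_odd_if[of n] period_doubling_binary[of n] by auto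

end

theory Submission
  imports Defs
begin

text \<open>
  For a scalar \<open>x\<close> let \<open>f n x\<close> be the Hankel determinant of order \<open>n\<close> of the shifted sequence
  \<open>d + x\<close>; it is an affine function of \<open>x\<close>. Sorting the indices by parity, the recursion for \<open>d\<close>
  turns the Hankel matrix of order \<open>2n\<close> into a block matrix with blocks \<open>A, A - H, A - H, A\<close>, where
  \<open>H\<close> is the Hankel matrix of order \<open>n\<close> and \<open>A\<close> has all entries \<open>1 + x\<close>. This gives
  \<open>f (2n) x = (-1)\<^sup>n f n 0 f n (-2 - 2x)\<close>.
  For odd \<open>j\<close> the matrix of \<open>d - 1\<close> vanishes where the row and column indices have the same parity,
  and even indices are in the majority; hence \<open>f j (-1) = 0\<close>, that is, \<open>f j x = f j 0 (1 + x)\<close>.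
  So \<open>f j\<close> is proportional to \<open>f 1\<close>, and the recursion, being homogeneous of degree two,
  propagates the proportionality to \<open>f (2\<^sup>m j)\<close> and \<open>f (2\<^sup>m)\<close>.
\<close>

text \<open>A constant matrix has rank one, so it can be encoded by bordering \<open>A\<close> with
  a column of ones and a row of \<open>- t\<close>. The bordered determinant has the required value,
  and \<open>t\<close> occurs only in its last row.\<close>

lemma det_add_const_affine:
  fixes A :: "'a :: idom mat"
  assumes A: "A \<in> carrier_mat n n"
  shows "\<exists>c. \<forall>t. det (A + mat n n (\<lambda>_. t)) = det A + t * c"
proof -
  define N where "N t = four_block_mat A (mat n 1 (\<lambda>_. 1)) (mat 1 n (\<lambda>_. - t)) (1\<^sub>m 1)" for t
  have N: "N t \<in> carrier_mat (n + 1) (n + 1)" for t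
    unfolding N_def by (rule four_block_carrier_mat[OF A one_carrier_mat])
  have det_N: "det (N t) = det (A + mat n n (\<lambda>_. t))" for t
  proof -
    \<comment> \<open>Multiplying by \<open>?L\<close> on the right adds \<open>t\<close> times the
      last column to the others, which clears the row of \<open>- t\<close>.\<close>
    let ?L = "four_block_mat (1\<^sub>m n) (0\<^sub>m n 1) (mat 1 n (\<lambda>_. t)) (1\<^sub>m 1)"
    have "N t * ?L = four_block_mat (A + mat n n (\<lambda>_. t)) (mat n 1 (\<lambda>_. 1)) (0\<^sub>m 1 n) (1\<^sub>m 1)"
      unfolding N_def using A
      by (subst mult_four_block_mat[where ?nr1.0 = n and ?n1.0 = n and ?n2.0 = 1 and ?nr2.0 = 1
            and ?nc1.0 = n and ?nc2.0 = 1])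
        (auto intro!: cong_four_block_mat simp: scalar_prod_def)
    moreover have "det (four_block_mat (A + mat n n (\<lambda>_. t)) (mat n 1 (\<lambda>_. 1)) (0\<^sub>m 1 n) (1\<^sub>m 1)) =
        det (A + mat n n (\<lambda>_. t)) * det (1\<^sub>m 1 :: 'a mat)"
      using A by (intro det_four_block_mat_lower_left_zero) auto
    moreover have "det ?L = det (1\<^sub>m n :: 'a mat) * det (1\<^sub>m 1 :: 'a mat)"
      by (intro det_four_block_mat_upper_right_zero) auto
    moreover have "det (N t * ?L) = det (N t) * det ?L"
      by (rule det_mult[OF N four_block_carrier_mat[OF one_carrier_mat one_carrier_mat]])
    ultimately show ?thesis by simp
  qed
  \<comment> \<open>Deleting the last row removes every occurrence of \<open>t\<close>.\<close>
  have cof: "cofactor (N t) n i = cofactor (N 0) n i" for t i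
  proof -
    have "mat_delete (N t) n i = mat_delete (N 0) n i"
      unfolding mat_delete_def N_def using A by (intro eq_matI) auto
    then show ?thesis by (simp add: cofactor_def)
  qed
  have "det (N t) = cofactor (N 0) n n + t * (- (\<Sum>i<n. cofactor (N 0) n i))" for t
  proof -
    have "det (N t) = (\<Sum>i<n + 1. N t $$ (n, i) * cofactor (N t) n i)"
      by (rule laplace_expansion_row[OF N]) simp
    also have "\<dots> = (\<Sum>i<n + 1. N t $$ (n, i) * cofactor (N 0) n i)"
      by (simp only: cof[of t])
    also have "\<dots> = cofactor (N 0) n n + t * (- (\<Sum>i<n. cofactor (N 0) n i))"
      using A by (simp add: N_def sum_distrib_left sum_negf)
    finally show ?thesis .
  qed
  then have eq: "det (A + mat n n (\<lambda>_. t)) =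
      cofactor (N 0) n n + t * (- (\<Sum>i<n. cofactor (N 0) n i))" for t
    by (simp only: det_N)
  moreover have "A + mat n n (\<lambda>_. 0) = A"
    using A by (intro eq_matI) auto
  ultimately have "det A = cofactor (N 0) n n"
    by (metis add.right_neutral mult_zero_left)
  with eq show ?thesis by metis
qed

text \<open>The sign of \<open>p\<close> arises once from the rows and once from the columns, and
  its square is 1.\<close>

lemma det_permute_rows_cols:
  fixes F :: "nat \<Rightarrow> nat \<Rightarrow> 'a :: comm_ring_1"
  assumes p: "p permutes {0..<n}"
  shows "det (mat n n (\<lambda>(i, j). F (p i) (p j))) = det (mat n n (\<lambda>(i, j). F i j))"
proof -
  have less: "p i < n" if "i < n" for i
    using permutes_in_image[OF p, of i] that by simp
  define B where "B = mat n n (\<lambda>(i, j). F i (p j))"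
  have "mat n n (\<lambda>(i, j). F (p i) (p j)) = mat n n (\<lambda>(i, j). B $$ (p i, j))"
    by (intro eq_matI) (auto simp: B_def less)
  then have 1: "det (mat n n (\<lambda>(i, j). F (p i) (p j))) = signof p * det B"
    using det_permute_rows[OF _ p, of B] by (simp add: B_def)
  have "transpose_mat B = mat n n (\<lambda>(i, j). transpose_mat (mat n n (\<lambda>(i, j). F i j)) $$ (p i, j))"
    by (intro eq_matI) (auto simp: B_def less)
  then have "det (transpose_mat B) = signof p * det (transpose_mat (mat n n (\<lambda>(i, j). F i j)))"
    using det_permute_rows[OF _ p, of "transpose_mat (mat n n (\<lambda>(i, j). F i j))"] by simp
  then have 2: "det B = signof p * det (mat n n (\<lambda>(i, j). F i j))"
    by (simp add: det_transpose[where n = n] B_def)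
  have "signof p * (signof p * x) = (x :: 'a)" for x
    by (simp add: sign_def)
  then show ?thesis unfolding 1 2 .
qed

text \<open>Lists the even indices first, then the odd ones. It is the identity from
  \<open>2 * n\<close> on because \<open>permutes\<close> demands fixed points outside the
  set.\<close>

definition unshuffle :: "nat \<Rightarrow> nat \<Rightarrow> nat" where
  "unshuffle n i = (if i < n then 2 * i else if i < 2 * n then 2 * (i - n) + 1 else i)"

lemma unshuffle_permutes: "unshuffle n permutes {0..<n + n}"
proof (rule bij_imp_permutes)
  have "inj_on (unshuffle n) {0..<n + n}"
    unfolding inj_on_def unshuffle_def by (auto split: if_splits) presburger+
  moreover have "unshuffle n ` {0..<n + n} \<subseteq> {0..<n + n}"
    by (auto simp: unshuffle_def)
  ultimately show "bij_betw (unshuffle n) {0..<n + n} {0..<n + n}"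
    by (simp add: bij_betw_def endo_inj_surj)
qed (simp add: unshuffle_def)

text \<open>Conjugation by the unipotent \<open>?U\<close> makes the matrix block lower triangular
  with diagonal blocks \<open>A + B\<close> and \<open>A - B\<close>.\<close>

lemma det_symmetric_blocks:
  fixes A B :: "'a :: idom mat"
  assumes A: "A \<in> carrier_mat n n" and B: "B \<in> carrier_mat n n"
  shows "det (four_block_mat A B B A) = det (A + B) * det (A - B)"
proof -
  let ?U = "four_block_mat (1\<^sub>m n) (1\<^sub>m n) (0\<^sub>m n n) (1\<^sub>m n) :: 'a mat"
  let ?V = "four_block_mat (1\<^sub>m n) (0\<^sub>m n n) (1\<^sub>m n) (1\<^sub>m n) :: 'a mat"
  let ?M = "four_block_mat A B B A"
  have M: "?M \<in> carrier_mat (n + n) (n + n)" and U: "?U \<in> carrier_mat (n + n) (n + n)"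
    using A B by auto
  have "?U * ?M = four_block_mat (A + B) (B + A) B A"
    using A B by (subst mult_four_block_mat[where ?nr1.0 = n and ?n1.0 = n and ?n2.0 = n
          and ?nr2.0 = n and ?nc1.0 = n and ?nc2.0 = n]) auto
  also have "\<dots> = four_block_mat (A + B) (0\<^sub>m n n) B (A - B) * ?U"
    using A B by (subst mult_four_block_mat[where ?nr1.0 = n and ?n1.0 = n and ?n2.0 = n
          and ?nr2.0 = n and ?nc1.0 = n and ?nc2.0 = n])
      (auto intro!: cong_four_block_mat comm_add_mat)
  finally have "det ?U * det ?M = det (four_block_mat (A + B) (0\<^sub>m n n) B (A - B)) * det ?U"
    using A B by (metis det_mult four_block_carrier_mat minus_carrier_mat add_carrier_mat M U)
  moreover have "det ?U = det (1\<^sub>m n :: 'a mat) * det (1\<^sub>m n :: 'a mat)"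
    by (intro det_four_block_mat_lower_left_zero) auto
  moreover have "det (four_block_mat (A + B) (0\<^sub>m n n) B (A - B)) = det (A + B) * det (A - B)"
    using A B by (intro det_four_block_mat_upper_right_zero) auto
  ultimately show ?thesis by simp
qed

text \<open>By pigeonhole every permutation sends some element of \<open>I\<close> into
  \<open>J\<close>, so each Leibniz term contains a zero factor.\<close>

lemma det_zero_if_zero_block:
  assumes A: "A \<in> carrier_mat n n"
    and I: "I \<subseteq> {0..<n}" and J: "J \<subseteq> {0..<n}"
    and card: "n < card I + card J"
    and zero: "\<And>i j. i \<in> I \<Longrightarrow> j \<in> J \<Longrightarrow> A $$ (i, j) = 0"
  shows "det A = 0"
  unfolding det_def'[OF A]
proof (rule sum.neutral, rule ballI)
  fix p assume "p \<in> {p. p permutes {0..<n}}"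
  then have p: "p permutes {0..<n}" by simp
  have "p ` I \<inter> J \<noteq> {}"
  proof
    assume disj: "p ` I \<inter> J = {}"
    have fin: "finite I" "finite J"
      using I J finite_subset by blast+
    have "p ` I \<union> J \<subseteq> {0..<n}"
      using I J permutes_image[OF p] by blast
    then have "card (p ` I \<union> J) \<le> n"
      using card_mono[of "{0..<n}"] by fastforce
    moreover have "card (p ` I \<union> J) = card I + card J"
      using card_Un_disjoint[OF finite_imageI[OF fin(1)] fin(2) disj]
        card_image[OF permutes_inj_on[OF p]] by simp
    ultimately show False using card by simp
  qed
  then obtain i where "i \<in> I" "p i \<in> J" by blast
  then have "(\<Prod>i = 0..<n. A $$ (i, p i)) = 0"
    using zero I by (intro prod_zero) auto
  then show "signof p * (\<Prod>i = 0..<n. A $$ (i, p i)) = 0" by simp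
qed

lemma hankel_det_shift_period_doubling_double:
  "hankel_det (\<lambda>k. period_doubling k + x) (2 * n) =
    (-1) ^ n * hankel_det period_doubling n * hankel_det (\<lambda>k. period_doubling k + (- 2 - 2 * x)) n"
proof -
  let ?F = "\<lambda>a b. period_doubling (a + b) + x"
  define A where "A = mat n n (\<lambda>_. 1 + x)"
  define H where "H = hankel_matrix period_doubling n"
  let ?K = "hankel_matrix (\<lambda>k. period_doubling k + (- 2 - 2 * x)) n"
  have A: "A \<in> carrier_mat n n" and H: "H \<in> carrier_mat n n" and AH: "A - H \<in> carrier_mat n n"
    and K: "?K \<in> carrier_mat n n"
    by (auto simp: A_def H_def hankel_matrix_def)
  have even_odd: "period_doubling (Suc (2 * a + 2 * b)) = 1 - period_doubling (a + b)"
    and odd_odd: "period_doubling (Suc (Suc (2 * a + 2 * b))) = 1"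
    and even_even: "period_doubling (2 * a + 2 * b) = 1" for a b
    using period_doubling_odd[of "a + b"] period_doubling_even[of "a + b"]
      period_doubling_even[of "a + b + 1"] by simp_all
  \<comment> \<open>Indices of equal parity have an even sum, giving the entry \<open>1 + x\<close>;
    mixed parities give \<open>1 + x\<close> minus an entry of \<open>H\<close>.\<close>
  have "mat (n + n) (n + n) (\<lambda>(i, j). ?F (unshuffle n i) (unshuffle n j)) =
      four_block_mat A (A - H) (A - H) A"
    by (rule eq_matI)
      (auto simp: A_def H_def hankel_matrix_def unshuffle_def even_odd odd_odd even_even)
  then have "hankel_det (\<lambda>k. period_doubling k + x) (2 * n) =
      det (four_block_mat A (A - H) (A - H) A)"
    using det_permute_rows_cols[OF unshuffle_permutes[of n], of ?F]
    by (simp add: hankel_det_def hankel_matrix_def mult_2)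
  also have "\<dots> = det (A + (A - H)) * det (A - (A - H))"
    by (rule det_symmetric_blocks[OF A AH])
  also have "A - (A - H) = H"
    using A H by (intro eq_matI) auto
  \<comment> \<open>Each entry is \<open>2 + 2 * x\<close> minus an entry of \<open>H\<close>;
    negating it yields the new shift \<open>- 2 - 2 * x\<close>.\<close>
  also have "A + (A - H) = (-1) \<cdot>\<^sub>m ?K"
    by (intro eq_matI) (auto simp: A_def H_def hankel_matrix_def)
  also have "det \<dots> = (-1) ^ n * det ?K"
    using K by (metis det_smult carrier_matD(2))
  finally show ?thesis
    by (simp add: hankel_det_def H_def)
qed

lemma hankel_det_shift_affine:
  fixes u :: "nat \<Rightarrow> 'a :: idom"
  shows "\<exists>c. \<forall>x. hankel_det (\<lambda>k. u k + x) n = hankel_det u n + x * c"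
proof -
  have "hankel_matrix (\<lambda>k. u k + x) n = hankel_matrix u n + mat n n (\<lambda>_. x)" for x
    by (intro eq_matI) (auto simp: hankel_matrix_def)
  then show ?thesis
    using det_add_const_affine[of "hankel_matrix u n" n]
    by (simp add: hankel_det_def) (simp add: hankel_matrix_def)
qed

lemma hankel_det_period_doubling_minus_one:
  assumes "odd j"
  shows "hankel_det (\<lambda>k. period_doubling k - 1) j = 0"
proof -
  obtain n where j: "j = 2 * n + 1" using assms by (elim oddE)
  \<comment> \<open>These are the \<open>n + 1\<close> even indices below \<open>2 * n + 1\<close>;
    used for both rows and columns, they exceed the order by one.\<close>
  define E where "E = (\<lambda>i. 2 * i) ` {0..n}"
  have "card E = n + 1"
    unfolding E_def by (subst card_image) (auto simp: inj_on_def)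
  moreover have "period_doubling (a + b) = 1" if ab: "a \<in> E" "b \<in> E" for a b
  proof -
    from ab obtain a' b' where "a = 2 * a'" "b = 2 * b'" unfolding E_def by blast
    then show ?thesis using period_doubling_even[of "a' + b'"] by simp
  qed
  moreover have "E \<subseteq> {0..<j}" by (auto simp: E_def j)
  ultimately show ?thesis
    unfolding hankel_det_def
    by (intro det_zero_if_zero_block[where n = j and I = E and J = E])
      (auto simp: hankel_matrix_def j subset_iff)
qed

lemma hankel_det_shift_period_doubling_odd:
  assumes "odd j"
  shows "hankel_det (\<lambda>k. period_doubling k + x) j = hankel_det period_doubling j * (1 + x)"
proof -
  obtain c where c: "\<And>x. hankel_det (\<lambda>k. period_doubling k + x) j = hankel_det period_doubling j + x * c"
    using hankel_det_shift_affine by blast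
  \<comment> \<open>The zero at \<open>-1\<close> fixes the slope.\<close>
  with hankel_det_period_doubling_minus_one[OF assms] have "c = hankel_det period_doubling j"
    using c[of "-1"] by simp
  with c show ?thesis by (simp add: algebra_simps)
qed

lemma hankel_det_shift_period_doubling_power2_mult:
  assumes "odd j"
  shows "hankel_det (\<lambda>k. period_doubling k + x) (2 ^ m * j) =
    hankel_det period_doubling j ^ 2 ^ m * hankel_det (\<lambda>k. period_doubling k + x) (2 ^ m)"
proof (induction m arbitrary: x)
  case 0
  have "hankel_det period_doubling 1 = 1"
    using period_doubling_even[of 0] by (simp add: hankel_det_def hankel_matrix_def det_single)
  then show ?case
    using hankel_det_shift_period_doubling_odd[OF assms, of x]
      hankel_det_shift_period_doubling_odd[of 1 x] by simp
next
  case (Suc m)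
  \<comment> \<open>As \<open>j\<close> is odd, both exponents have the same parity.\<close>
  have sign: "(-1 :: int) ^ (2 ^ m * j) = (-1) ^ 2 ^ m"
    using assms by (simp add: uminus_power_if)
  \<comment> \<open>The hypothesis is applied at the shifts \<open>0\<close> and
    \<open>- 2 - 2 * x\<close>, hence the induction over arbitrary \<open>x\<close>; each use
    contributes one factor of the square.\<close>
  have "hankel_det (\<lambda>k. period_doubling k + x) (2 * (2 ^ m * j)) =
      (hankel_det period_doubling j ^ 2 ^ m) ^ 2 * hankel_det (\<lambda>k. period_doubling k + x) (2 * 2 ^ m)"
    unfolding hankel_det_shift_period_doubling_double sign Suc.IH[of "- 2 - 2 * x"]
    using Suc.IH[of 0] by (simp add: power2_eq_square)
  then show ?case
    by (simp add: mult.assoc power_mult[symmetric] mult.commute[of 2])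
qed

theorem theorem11:
  fixes m j :: nat
  assumes "odd j"
  shows "hankel_det period_doubling (2 ^ m * j) =
    hankel_det period_doubling j ^ (2 ^ m) * hankel_det period_doubling (2 ^ m)"
  using hankel_det_shift_period_doubling_power2_mult[OF assms, of 0 m] by simp

end
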